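(* Let $d\ge 2$. Let $\mathcal{H}_0$ be the hypothesis that samples are drawn i.i.d. from the uniform distribution on $\{0,\dots,d-1\}$, and let $\mathcal{H}_1$ be the hypothesis that samples are drawn i.i.d. from the distribution $p_U(x)=|\bra{x}U\ket{0}|^2$, $x\in\{0,\dots,d-1\}$, where $U$ is an unknown $d\times d$ Haar-random unitary (drawn once, the same for all samples). Then there exists a test based on $N=\mathcal{O}(\sqrt{d})$ independent samples that decides between $\mathcal{H}_0$ and $\mathcal{H}_1$ with success probability at least $2/3$.
   Context: $\{\ket{x}\}_{x=0}^{d-1}$ denotes the computational basis of $\mathbb{C}^d$. *)

theory Defs
  imports "HOL-Probability.Probability"
begin

text \<open>d x d complex matrices are represented as functions nat => nat => complex
  whose entries vanish outside the index range {0..<d}.\<close>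

definition mat_mult :: "nat \<Rightarrow> (nat \<Rightarrow> nat \<Rightarrow> complex) \<Rightarrow> (nat \<Rightarrow> nat \<Rightarrow> complex) \<Rightarrow> (nat \<Rightarrow> nat \<Rightarrow> complex)" where
  "mat_mult d A B = (\<lambda>i j. if i < d \<and> j < d then (\<Sum>k<d. A i k * B k j) else 0)"

definition unitary_mats :: "nat \<Rightarrow> (nat \<Rightarrow> nat \<Rightarrow> complex) set" where
  "unitary_mats d = {U. (\<forall>i j. (d \<le> i \<or> d \<le> j) \<longrightarrow> U i j = 0) \<and>
     (\<forall>i<d. \<forall>k<d. (\<Sum>j<d. U i j * cnj (U k j)) = (if i = k then 1 else 0))}"

text \<open>Borel sigma algebra on U(d): generated by the (Borel measurable) matrix entries.\<close>
definition unitary_sets :: "nat \<Rightarrow> (nat \<Rightarrow> nat \<Rightarrow> complex) set set" where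
  "unitary_sets d = sigma_sets (unitary_mats d)
     {(\<lambda>U. U i j) -` B \<inter> unitary_mats d | i j B. B \<in> sets (borel :: complex measure)}"

definition haar_unitary :: "nat \<Rightarrow> (nat \<Rightarrow> nat \<Rightarrow> complex) measure \<Rightarrow> bool" where
  "haar_unitary d M \<longleftrightarrow> prob_space M \<and> space M = unitary_mats d \<and> sets M = unitary_sets d \<and>
     (\<forall>V \<in> unitary_mats d. \<forall>A \<in> sets M.
        (\<lambda>U. mat_mult d V U) -` A \<inter> space M \<in> sets M \<and>
        emeasure M ((\<lambda>U. mat_mult d V U) -` A \<inter> space M) = emeasure M A)"

definition p_U :: "nat \<Rightarrow> (nat \<Rightarrow> nat \<Rightarrow> complex) \<Rightarrow> nat pmf" where
  "p_U d U = embed_pmf (\<lambda>x. if x < d then (cmod (U x 0))^2 else 0)"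

end

theory Submission
  imports Defs
begin

text \<open>
  The test counts colliding pairs among the samples. For every distribution \<open>p\<close> on \<open>d\<close> points the
  count has mean \<open>pairs n * \<Sum>p\<^sup>2\<close>, and since \<open>\<Sum>p\<^sup>3 \<le> (\<Sum>p\<^sup>2)\<^bsup>3/2\<^esup>\<close> its relative variance is
  \<open>O(1/K)\<close> once \<open>n \<ge> K * sqrt d\<close>. So it estimates \<open>\<Sum>p\<^sup>2\<close> up to a small factor, which is
  \<open>1/d\<close> for the uniform distribution and has mean \<open>2/(d+1)\<close> for a random column.

  Moments of the squared moduli \<open>s\<^sub>x\<close> of the random column follow from invariance under
  unitaries that mix two rows \<open>x\<close>, \<open>y\<close> only: averaging over the relative phase gives
  \<open>E g s\<^sub>x s\<^sub>y = E g s\<^sub>x\<^sup>2 / 2\<close> for symmetric weights \<open>g\<close> and \<open>E s\<^sub>x\<^sup>2 s\<^sub>y\<^sup>2 = E s\<^sub>x\<^sup>4 / 6\<close>, and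
  \<open>\<Sum>s\<^sub>x = 1\<close> fixes the normalisation. The resulting variance of \<open>\<Sum>s\<^sub>x\<^sup>2\<close> bounds the
  probability that it is close to \<open>1/d\<close> by 0.48 for every \<open>d \<ge> 2\<close>. This is less than 1/2, which a
  suitably randomised test tolerates.
\<close>

subsection \<open>The collision statistic\<close>

text \<open>Peeling off the head parallels the recursion of \<open>iid_sum\<close>, so moments of
  the count follow by induction on the number of samples.\<close>

primrec collisions :: "'a list \<Rightarrow> nat" where
  "collisions [] = 0"
| "collisions (x # xs) = collisions xs + count_list xs x"

text \<open>The expectation over \<open>n\<close> independent samples as a nested finite sum. It is
  a polynomial in the values of \<open>p\<close>, which later gives measurability in the random
  unitary.\<close>

primrec iid_sum :: "nat \<Rightarrow> (nat \<Rightarrow> real) \<Rightarrow> nat \<Rightarrow> (nat list \<Rightarrow> real) \<Rightarrow> real" where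
  "iid_sum d p 0 f = f []"
| "iid_sum d p (Suc n) f = (\<Sum>x<d. p x * iid_sum d p n (\<lambda>xs. f (x # xs)))"

lemma expectation_replicate_pmf:
  fixes f :: "nat list \<Rightarrow> real"
  assumes "set_pmf q \<subseteq> {..<d}"
  shows "measure_pmf.expectation (replicate_pmf n q) f = iid_sum d (pmf q) n f"
proof (induction n arbitrary: f)
  case 0
  then show ?case by simp
next
  case (Suc n)
  have fin: "finite (set_pmf q)"
    using assms finite_subset by blast
  have fin_n: "finite (set_pmf (replicate_pmf n q))"
    unfolding set_replicate_pmf using finite_lists_length_eq[OF fin, of n]
    by (simp add: lists_eq_set)
  have "measure_pmf.expectation (replicate_pmf (Suc n) q) f =
      (\<Sum>x<d. pmf q x *\<^sub>R measure_pmf.expectation (map_pmf ((#) x) (replicate_pmf n q)) f)"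
    unfolding replicate_pmf.simps map_pmf_def[symmetric]
    by (rule pmf_expectation_bind) (use assms fin_n in auto)
  also have "\<dots> = iid_sum d (pmf q) (Suc n) f"
    by (simp add: Suc.IH)
  finally show ?case .
qed

abbreviation pairs :: "nat \<Rightarrow> real" where
  "pairs n \<equiv> n * (real n - 1) / 2"

text \<open>Sample lists may contain any natural number. By \<open>outside\<close>, entries beyond
  the range weigh 0, so the counting identities below hold for every list.\<close>

locale finite_distribution =
  fixes d :: nat and p :: "nat \<Rightarrow> real"
  assumes nonneg: "0 \<le> p x"
    and outside: "d \<le> x \<Longrightarrow> p x = 0"
    and sum_1: "(\<Sum>x<d. p x) = 1"
begin

abbreviation "E n f \<equiv> iid_sum d p n f"

text \<open>For positive \<open>k\<close>, the probability that \<open>k\<close> independent samples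
  all coincide.\<close>

definition power_sum :: "nat \<Rightarrow> real" where
  "power_sum k = (\<Sum>x<d. p x ^ k)"

lemma iid_sum_add: "E n (\<lambda>xs. f xs + g xs) = E n f + E n g"
  by (induction n arbitrary: f g) (simp_all add: sum.distrib distrib_left)

lemma iid_sum_cmult: "E n (\<lambda>xs. c * f xs) = c * E n f"
  by (induction n arbitrary: f) (simp_all add: sum_distrib_left mult.left_commute)

lemma iid_sum_const: "E n (\<lambda>xs. c) = c"
  by (induction n) (simp_all add: sum_1 flip: sum_distrib_right)

lemma iid_sum_mono: "(\<And>xs. f xs \<le> g xs) \<Longrightarrow> E n f \<le> E n g"
  by (induction n arbitrary: f g) (auto intro!: sum_mono mult_left_mono nonneg)

lemma iid_sum_sum: "finite A \<Longrightarrow> E n (\<lambda>xs. \<Sum>x\<in>A. f x xs) = (\<Sum>x\<in>A. E n (f x))"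
  by (induction A rule: finite_induct) (simp_all add: iid_sum_const iid_sum_add)

text \<open>The head can be averaged first with the tail held fixed, so each moment induction needs
  only a conditional expectation over one new sample.\<close>

lemma iid_sum_Suc: "E (Suc n) f = E n (\<lambda>xs. \<Sum>x<d. p x * f (x # xs))"
  by (simp add: iid_sum_sum iid_sum_cmult)

section \<open>Conditional expectations over one new sample\<close>

definition weight :: "nat \<Rightarrow> nat list \<Rightarrow> real" where
  "weight k xs = (\<Sum>y\<leftarrow>xs. p y ^ k)"

text \<open>The conditional second moment of the number of collisions that one new sample creates
  with \<open>xs\<close>; the conditional mean is \<open>weight 1 xs\<close>.\<close>

definition square_count :: "nat list \<Rightarrow> real" where
  "square_count xs = (\<Sum>x<d. p x * real (count_list xs x) ^ 2)"

lemma weight_Cons [simp]: "weight k (x # xs) = p x ^ k + weight k xs"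
  and weight_Nil [simp]: "weight k [] = 0"
  by (simp_all add: weight_def)

lemma sum_count_list:
  assumes "0 < k"
  shows "(\<Sum>x<d. p x ^ k * real (count_list xs x)) = weight k xs"
proof (induction xs)
  case (Cons y ys)
  have "(\<Sum>x<d. p x ^ k * real (count_list (y # ys) x)) =
      (\<Sum>x<d. (if x = y then p x ^ k else 0) + p x ^ k * real (count_list ys x))"
    by (intro sum.cong) (auto simp: algebra_simps)
  also have "\<dots> = weight k (y # ys)"
    using outside[of y] assms by (simp add: sum.distrib Cons.IH zero_power)
  finally show ?case .
qed simp

lemma square_count_Cons:
  "square_count (y # xs) = square_count xs + p y * (2 * real (count_list xs y) + 1)"
proof -
  have "square_count (y # xs) = (\<Sum>x<d. (if x = y then p x * (2 * real (count_list xs x) + 1) else 0)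
      + p x * real (count_list xs x) ^ 2)"
    unfolding square_count_def
    by (intro sum.cong) (auto simp: algebra_simps power2_eq_square)
  then show ?thesis
    using outside[of y] by (simp add: sum.distrib square_count_def)
qed

lemma power_sum_alt:
  "(\<Sum>x<d. p x * p x) = power_sum 2" "(\<Sum>x<d. p x * p x ^ 2) = power_sum 3"
  by (simp_all add: power_sum_def power2_eq_square power3_eq_cube mult.assoc)

lemma mean_weight: "E n (weight k) = n * power_sum (Suc k)"
proof (induction n)
  case (Suc n)
  have "(\<Sum>x<d. p x * weight k (x # xs)) = power_sum (Suc k) + weight k xs" for xs
    by (simp add: distrib_left sum.distrib sum_1 power_sum_def flip: sum_distrib_right)
  then show ?case
    by (simp add: iid_sum_Suc iid_sum_add iid_sum_const Suc algebra_simps del: iid_sum.simps)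
qed simp

text \<open>The square expands into \<open>n\<close> diagonal terms of mean
  \<open>power_sum 3\<close> and \<open>n * (n - 1)\<close> ordered pairs of independent
  terms.\<close>

lemma mean_weight_square:
  "E n (\<lambda>xs. weight 1 xs ^ 2) = n * power_sum 3 + n * (real n - 1) * power_sum 2 ^ 2"
proof (induction n)
  case (Suc n)
  have "(\<Sum>x<d. p x * weight 1 (x # xs) ^ 2) =
      (\<Sum>x<d. p x * p x ^ 2 + 2 * weight 1 xs * (p x * p x) + weight 1 xs ^ 2 * p x)" for xs
    by (intro sum.cong) (auto simp: algebra_simps power2_eq_square)
  then have "(\<Sum>x<d. p x * weight 1 (x # xs) ^ 2) =
      power_sum 3 + 2 * power_sum 2 * weight 1 xs + weight 1 xs ^ 2" for xs
    unfolding sum.distrib sum_distrib_left[symmetric] power_sum_alt sum_1 by simp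
  then have "E (Suc n) (\<lambda>xs. weight 1 xs ^ 2) =
      power_sum 3 + 2 * power_sum 2 * E n (weight 1) + E n (\<lambda>xs. weight 1 xs ^ 2)"
    unfolding iid_sum_Suc by (simp only: iid_sum_add iid_sum_const iid_sum_cmult)
  also have "\<dots> = real (Suc n) * power_sum 3 + real (Suc n) * (real (Suc n) - 1) * power_sum 2 ^ 2"
    unfolding Suc mean_weight by (simp add: algebra_simps power2_eq_square numeral_2_eq_2)
  finally show ?case .
qed simp

text \<open>Pairs of equal positions contribute \<open>power_sum 2\<close>, ordered pairs of
  distinct positions contribute \<open>power_sum 3\<close>.\<close>

lemma mean_square_count:
  "E n square_count = n * power_sum 2 + n * (real n - 1) * power_sum 3"
proof (induction n)
  case 0
  then show ?case by (simp add: square_count_def)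
next
  case (Suc n)
  have "(\<Sum>x<d. p x * square_count (x # xs)) =
      (\<Sum>x<d. square_count xs * p x + 2 * (p x ^ 2 * real (count_list xs x)) + p x * p x)" for xs
    by (intro sum.cong) (auto simp: algebra_simps power2_eq_square square_count_Cons)
  then have "(\<Sum>x<d. p x * square_count (x # xs)) =
      square_count xs + 2 * weight 2 xs + power_sum 2" for xs
    by (simp add: sum.distrib sum_1 power_sum_alt sum_count_list flip: sum_distrib_left)
  then show ?case
    using mean_weight[of n 2]
    by (simp add: iid_sum_Suc iid_sum_add iid_sum_const iid_sum_cmult Suc algebra_simps
        del: iid_sum.simps)
qed

section \<open>First and second moments of the collision count\<close>

lemma sum_collisions_Cons:
  "(\<Sum>x<d. p x * real (collisions (x # xs))) = real (collisions xs) + weight 1 xs"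
  using sum_count_list[of 1 xs]
  by (simp add: distrib_left sum.distrib sum_1 flip: sum_distrib_right)

lemma mean_collisions: "E n (\<lambda>xs. real (collisions xs)) = n * (real n - 1) / 2 * power_sum 2"
proof (induction n)
  case (Suc n)
  then show ?case
    using mean_weight[of n 1]
    by (simp add: iid_sum_Suc sum_collisions_Cons iid_sum_add field_simps numeral_2_eq_2
        del: iid_sum.simps collisions.simps)
qed simp

text \<open>A pair of positions meets a single position: either the position lies in the pair, which
  gives \<open>power_sum 3\<close>, or it is independent of the pair.\<close>

lemma mean_collisions_weight:
  "E n (\<lambda>xs. real (collisions xs) * weight 1 xs) =
    n * (real n - 1) * power_sum 3 + n * (real n - 1) * (real n - 2) / 2 * power_sum 2 ^ 2"
proof (induction n)
  case (Suc n)
  have "(\<Sum>x<d. p x * (real (collisions (x # xs)) * weight 1 (x # xs))) =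
      (\<Sum>x<d. weight 1 xs * (p x * real (collisions (x # xs))) + real (collisions xs) * (p x * p x)
         + p x ^ 2 * real (count_list xs x))" for xs
    by (intro sum.cong) (auto simp: algebra_simps power2_eq_square)
  then have "(\<Sum>x<d. p x * (real (collisions (x # xs)) * weight 1 (x # xs))) =
      real (collisions xs) * weight 1 xs + weight 1 xs ^ 2 + power_sum 2 * real (collisions xs)
        + weight 2 xs" for xs
    using sum_collisions_Cons[of xs]
    unfolding sum.distrib sum_distrib_left[symmetric] power_sum_alt sum_count_list[OF zero_less_numeral]
    by (simp add: algebra_simps power2_eq_square del: collisions.simps)
  then have "E (Suc n) (\<lambda>xs. real (collisions xs) * weight 1 xs) =
      E n (\<lambda>xs. real (collisions xs) * weight 1 xs) + E n (\<lambda>xs. weight 1 xs ^ 2)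
        + power_sum 2 * E n (\<lambda>xs. real (collisions xs)) + E n (weight 2)"
    unfolding iid_sum_Suc by (simp only: iid_sum_add iid_sum_cmult)
  also have "\<dots> = real (Suc n) * (real (Suc n) - 1) * power_sum 3
      + real (Suc n) * (real (Suc n) - 1) * (real (Suc n) - 2) / 2 * power_sum 2 ^ 2"
    unfolding Suc mean_weight mean_weight_square mean_collisions
    by (simp add: field_simps power2_eq_square)
  finally show ?case .
qed simp

text \<open>The three terms count two pairs of positions that are equal, share one position, or are
  disjoint.\<close>

lemma mean_collisions_square:
  "E n (\<lambda>xs. real (collisions xs) ^ 2) =
    n * (real n - 1) / 2 * power_sum 2 + n * (real n - 1) * (real n - 2) * power_sum 3
    + n * (real n - 1) * (real n - 2) * (real n - 3) / 4 * power_sum 2 ^ 2"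
proof (induction n)
  case (Suc n)
  have "(\<Sum>x<d. p x * real (collisions (x # xs)) ^ 2) =
      (\<Sum>x<d. real (collisions xs) ^ 2 * p x
         + 2 * real (collisions xs) * (p x ^ 1 * real (count_list xs x))
         + p x * real (count_list xs x) ^ 2)" for xs
    by (intro sum.cong) (auto simp: algebra_simps power2_eq_square)
  then have "(\<Sum>x<d. p x * real (collisions (x # xs)) ^ 2) =
      real (collisions xs) ^ 2 + 2 * (real (collisions xs) * weight 1 xs) + square_count xs" for xs
    unfolding sum.distrib sum_distrib_left[symmetric] sum_count_list[OF zero_less_one]
    by (simp add: sum_1 square_count_def)
  then have "E (Suc n) (\<lambda>xs. real (collisions xs) ^ 2) =
      E n (\<lambda>xs. real (collisions xs) ^ 2)
        + 2 * E n (\<lambda>xs. real (collisions xs) * weight 1 xs) + E n square_count"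
    unfolding iid_sum_Suc by (simp only: iid_sum_add iid_sum_cmult)
  also have "\<dots> = real (Suc n) * (real (Suc n) - 1) / 2 * power_sum 2
      + real (Suc n) * (real (Suc n) - 1) * (real (Suc n) - 2) * power_sum 3
      + real (Suc n) * (real (Suc n) - 1) * (real (Suc n) - 2) * (real (Suc n) - 3) / 4 * power_sum 2 ^ 2"
    unfolding Suc mean_collisions_weight mean_square_count
    by (simp add: field_simps power2_eq_square)
  finally show ?case .
qed simp


section \<open>Concentration of the collision count\<close>

lemma variance_collisions_le:
  "E n (\<lambda>xs. (real (collisions xs) - pairs n * power_sum 2) ^ 2) \<le>
    pairs n * power_sum 2 + 2 * pairs n * real n * power_sum 3"
proof -
  define m where "m = pairs n * power_sum 2"
  have "E n (\<lambda>xs. (real (collisions xs) - m) ^ 2) =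
      E n (\<lambda>xs. real (collisions xs) ^ 2 + (- 2 * m) * real (collisions xs) + m ^ 2)"
    by (simp add: power2_eq_square algebra_simps)
  also have "\<dots> = E n (\<lambda>xs. real (collisions xs) ^ 2) + (- 2 * m) * m + m ^ 2"
    unfolding iid_sum_add iid_sum_cmult iid_sum_const mean_collisions m_def ..
  also have "\<dots> = pairs n * power_sum 2 + n * (real n - 1) * (real n - 2) * power_sum 3
      + n * (real n - 1) * (3 - 2 * real n) / 2 * power_sum 2 ^ 2"
    unfolding mean_collisions_square m_def by (simp add: field_simps power2_eq_square)
  also have "\<dots> \<le> pairs n * power_sum 2 + 2 * pairs n * real n * power_sum 3 + 0"
  proof (intro add_mono order_refl)
    have r: "0 \<le> power_sum 3"
      by (simp add: power_sum_def sum_nonneg nonneg)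
    \<comment> \<open>Integrality matters here: \<open>n * (n - 1)\<close> would be negative
      strictly between 0 and 1, and \<open>3 - 2 * n\<close> is still positive at 1, where the other
      factor vanishes.\<close>
    have n: "n = 0 \<or> n = 1 \<or> 2 \<le> real n"
      by linarith
    then have pn: "0 \<le> n * (real n - 1)"
      by auto
    have "n * (real n - 1) * (real n - 2) \<le> n * (real n - 1) * real n"
      by (rule mult_left_mono[OF _ pn]) simp
    from mult_right_mono[OF this r]
    show "n * (real n - 1) * (real n - 2) * power_sum 3 \<le> 2 * pairs n * real n * power_sum 3"
      by (simp add: field_simps)
    have "n * (real n - 1) * (3 - 2 * real n) \<le> 0"
      using n
    proof (elim disjE)
      assume "2 \<le> real n"
      then show ?thesis
        by (intro mult_nonneg_nonpos[OF pn]) simp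
    qed simp_all
    then show "n * (real n - 1) * (3 - 2 * real n) / 2 * power_sum 2 ^ 2 \<le> 0"
      by (intro mult_nonpos_nonneg) auto
  qed
  finally show ?thesis
    by (simp add: m_def)
qed

text \<open>Each single square is at most \<open>power_sum 2\<close>, so its root bounds every
  probability and one factor can be pulled out of the cubes.\<close>

lemma power_sum_3_le: "power_sum 3 \<le> sqrt (power_sum 2) * power_sum 2"
proof -
  have "p x \<le> sqrt (power_sum 2)" if "x < d" for x
  proof (rule real_le_rsqrt)
    show "p x ^ 2 \<le> power_sum 2"
      unfolding power_sum_def by (rule member_le_sum) (use that in auto)
  qed
  then have "p x ^ 3 \<le> sqrt (power_sum 2) * p x ^ 2" if "x < d" for x
    using that by (simp add: power3_eq_cube power2_eq_square nonneg mult_right_mono flip: mult.assoc)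
  then show ?thesis
    unfolding power_sum_def[of 3]
    by (subst (2) power_sum_def, subst sum_distrib_left) (auto intro: sum_mono)
qed

text \<open>Markov's inequality for the squared deviation. The event \<open>P\<close> only has to
  imply the deviation, so the same bound serves both tails.\<close>

lemma chebyshev_collisions:
  assumes K: "1 \<le> K" "K \<le> real n * sqrt (power_sum 2)" and n: "2 \<le> n" and e: "0 < e"
    and P: "\<And>xs. P xs \<Longrightarrow> e * (pairs n * power_sum 2) \<le> \<bar>real (collisions xs) - pairs n * power_sum 2\<bar>"
  shows "E n (\<lambda>xs. of_bool (P xs)) \<le> 12 / (K * e ^ 2)"
proof -
  define r where "r = sqrt (power_sum 2)"
  have r2: "power_sum 2 = r ^ 2"
    by (simp add: r_def power_sum_def sum_nonneg)
  have r: "0 < r"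
  proof (rule ccontr)
    assume "\<not> 0 < r"
    then have "real n * r \<le> 0"
      by (simp add: mult_nonneg_nonpos)
    then show False
      using K by (simp add: r_def)
  qed
  define c where "c = pairs n"
  have c: "real n ^ 2 / 4 \<le> c"
    using mult_left_mono[of 2 "real n" "real n"] n by (simp add: c_def field_simps power2_eq_square)
  moreover have "0 < real n ^ 2 / 4"
    using n by simp
  ultimately have c0: "0 < c"
    by linarith
  define m where "m = c * r ^ 2"
  have m0: "0 < m"
    using c0 r by (simp add: m_def)
  have "E n (\<lambda>xs. of_bool (P xs)) \<le>
      E n (\<lambda>xs. 1 / (e * m) ^ 2 * (real (collisions xs) - m) ^ 2)"
  proof (rule iid_sum_mono)
    fix xs
    show "of_bool (P xs) \<le> 1 / (e * m) ^ 2 * (real (collisions xs) - m) ^ 2"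
    proof (cases "P xs")
      case True
      have "(e * m) ^ 2 \<le> \<bar>real (collisions xs) - m\<bar> ^ 2"
        by (rule power_mono) (use P[OF True] e m0 in \<open>auto simp: m_def c_def r2\<close>)
      then show ?thesis
        using e m0 True by (simp add: field_simps)
    qed simp
  qed
  also have "\<dots> = 1 / (e * m) ^ 2 * E n (\<lambda>xs. (real (collisions xs) - m) ^ 2)"
    by (rule iid_sum_cmult)
  also have "\<dots> \<le> 1 / (e * m) ^ 2 * (m + 2 * c * real n * (r * r ^ 2))"
  proof (intro mult_left_mono)
    have "power_sum 3 \<le> r * power_sum 2"
      unfolding r_def by (rule power_sum_3_le)
    then have "power_sum 3 \<le> r * r ^ 2"
      by (simp only: r2)
    then have "2 * c * real n * power_sum 3 \<le> 2 * c * real n * (r * r ^ 2)"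
      using c0 by (intro mult_left_mono) auto
    then show "E n (\<lambda>xs. (real (collisions xs) - m) ^ 2) \<le> m + 2 * c * real n * (r * r ^ 2)"
      using variance_collisions_le[of n] by (simp add: m_def c_def r2)
  qed simp
  also have "\<dots> = (1 / (c * r ^ 2) + 2 * real n / (c * r)) / e ^ 2"
    using e c0 r by (simp add: m_def field_simps power2_eq_square)
  \<comment> \<open>The two variance terms relative to the squared mean are bounded separately, both
    through \<open>pairs n \<ge> n^2 / 4\<close>; the first also uses
    \<open>1 \<le> K\<close>.\<close>
  also have "\<dots> \<le> (4 / K + 8 / K) / e ^ 2"
  proof (intro divide_right_mono add_mono)
    have "K * 1 \<le> (real n * r) * (real n * r)"
      using K by (intro mult_mono) (auto simp: r_def)
    also have "\<dots> \<le> 4 * (c * r ^ 2)"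
      using mult_right_mono[OF c, of "r ^ 2"] by (simp add: power2_eq_square algebra_simps)
    finally show "1 / (c * r ^ 2) \<le> 4 / K"
      using K c0 r by (simp add: field_simps)
    have "2 * real n * K \<le> 2 * real n * (real n * r)"
      using K by (intro mult_left_mono) (auto simp: r_def)
    also have "\<dots> \<le> 8 * (c * r)"
      using mult_right_mono[OF c, of r] r by (simp add: power2_eq_square algebra_simps)
    finally show "2 * real n / (c * r) \<le> 8 / K"
      using K c0 r by (simp add: field_simps)
  qed simp
  finally show ?thesis
    by (simp add: field_simps)
qed

text \<open>The uniform distribution minimises the collision probability, hence order
  \<open>sqrt d\<close> samples suffice for concentration whatever the distribution.\<close>

lemma power_sum_2_ge: "0 < d \<Longrightarrow> 1 / d \<le> power_sum 2"
proof -
  assume d: "0 < d"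
  have "0 \<le> (\<Sum>x<d. (p x - 1 / d) ^ 2)"
    by (simp add: sum_nonneg)
  also have "\<dots> = (\<Sum>x<d. p x ^ 2 + (- 2 / d) * p x + 1 / d ^ 2)"
    by (intro sum.cong) (auto simp: power2_eq_square algebra_simps)
  also have "\<dots> = power_sum 2 - 1 / d"
    unfolding sum.distrib sum_distrib_left[symmetric] sum_1
    using d by (simp add: power_sum_def power2_eq_square)
  finally show ?thesis
    by simp
qed

section \<open>Errors of the threshold test for a fixed distribution\<close>

lemma collision_deviation:
  assumes d: "2 \<le> d" and n: "10 ^ 9 * sqrt d \<le> n"
    and P: "\<And>xs. P xs \<Longrightarrow> 0.005 * (pairs n * power_sum 2) \<le> \<bar>real (collisions xs) - pairs n * power_sum 2\<bar>"
  shows "E n (\<lambda>xs. of_bool (P xs)) \<le> 0.001"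
proof -
  have "2 \<le> real n" if "1 \<le> r" "10 ^ 9 * r \<le> n" for r :: real
    using that by simp
  from this[OF _ n] have "2 \<le> real n"
    using d by simp
  then have n2: "2 \<le> n"
    by simp
  have "10 ^ 9 = 10 ^ 9 * sqrt d * sqrt (1 / d)"
    using d by (simp add: real_sqrt_divide)
  also have "\<dots> \<le> n * sqrt (power_sum 2)"
    using d power_sum_2_ge by (intro mult_mono n) auto
  finally have "10 ^ 9 \<le> n * sqrt (power_sum 2)" .
  \<comment> \<open>With \<open>K = 10 ^ 9\<close> and \<open>e = 0.005\<close> the bound equals
    12/25000, that is 0.00048.\<close>
  then have "E n (\<lambda>xs. of_bool (P xs)) \<le> 12 / (10 ^ 9 * 0.005 ^ 2)"
    by (intro chebyshev_collisions n2 P) auto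
  then show ?thesis
    by (simp add: power2_eq_square)
qed

lemma pairs_nonneg: "0 \<le> pairs n"
  by (cases n) auto

text \<open>The threshold 1.01 lies between 1 and 1.02, and its relative distance from either
  exceeds 0.005. A larger \<open>power_sum 2\<close> only widens the gap.\<close>

lemma few_collisions_unlikely:
  assumes "2 \<le> d" "10 ^ 9 * sqrt d \<le> n" and q: "1.02 / d \<le> power_sum 2"
  shows "E n (\<lambda>xs. of_bool (collisions xs \<le> 1.01 * pairs n / d)) \<le> 0.001"
proof (rule collision_deviation[OF assms(1,2)])
  fix xs :: "nat list" assume few: "collisions xs \<le> 1.01 * pairs n / d"
  define a c where "a = pairs n / d" and "c = pairs n * power_sum 2"
  have "pairs n * (1.02 / d) \<le> c"
    unfolding c_def by (rule mult_left_mono[OF q pairs_nonneg])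
  then have "1.02 * a \<le> c"
    by (simp add: a_def)
  moreover have "0 \<le> a"
    using pairs_nonneg by (simp add: a_def)
  moreover have "real (collisions xs) \<le> 1.01 * a"
    using few by (simp add: a_def)
  ultimately have "0.005 * c \<le> c - real (collisions xs)"
    by simp
  then show "0.005 * (pairs n * power_sum 2) \<le> \<bar>real (collisions xs) - pairs n * power_sum 2\<bar>"
    unfolding c_def[symmetric] by linarith
qed

lemma many_collisions_unlikely:
  assumes "2 \<le> d" "10 ^ 9 * sqrt d \<le> n" and q: "power_sum 2 = 1 / d"
  shows "E n (\<lambda>xs. of_bool (\<not> collisions xs \<le> 1.01 * pairs n / d)) \<le> 0.001"
proof (rule collision_deviation[OF assms(1,2)])
  fix xs :: "nat list" assume "\<not> collisions xs \<le> 1.01 * pairs n / d"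
  moreover have "0 \<le> pairs n / d"
    using pairs_nonneg by simp
  ultimately show "0.005 * (pairs n * power_sum 2) \<le> \<bar>real (collisions xs) - pairs n * power_sum 2\<bar>"
    unfolding q by simp
qed

end

subsection \<open>Unitary matrices\<close>

lemma unitary_row:
  assumes "U \<in> unitary_mats d" "i < d" "k < d"
  shows "(\<Sum>j<d. U i j * cnj (U k j)) = (if i = k then 1 else 0)"
  using assms by (auto simp: unitary_mats_def)

text \<open>Bessel's inequality for the orthonormal rows bounds each column norm by 1, and the squared
  column norms add up to d.\<close>
lemma unitary_column:
  assumes U: "U \<in> unitary_mats d" and j: "j < d"
  shows "(\<Sum>i<d. cmod (U i j) ^ 2) = 1"
proof -
  define c where "c j = (\<Sum>i<d. cmod (U i j) ^ 2)" for j
  have bessel: "c j \<le> 1" if "j < d" for j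
  proof -
    \<comment> \<open>\<open>y\<close> is row \<open>j\<close> of the Gram matrix of the columns.
      Orthonormal rows make its squared norm \<open>c j\<close>, while its entry at \<open>j\<close>
      is \<open>c j\<close> too; hence \<open>c j ^ 2 \<le> c j\<close>.\<close>
    define y where "y k = (\<Sum>i<d. cnj (U i j) * U i k)" for k
    have yj: "y j = of_real (c j)"
      by (simp add: y_def c_def complex_norm_square mult.commute del: of_real_power)
    have "(\<Sum>k<d. y k * cnj (y k)) =
        (\<Sum>k<d. \<Sum>i<d. \<Sum>l<d. cnj (U i j) * U l j * (U i k * cnj (U l k)))"
      by (simp add: y_def sum_product mult_ac)
    also have "\<dots> = (\<Sum>i<d. \<Sum>l<d. cnj (U i j) * U l j * (\<Sum>k<d. U i k * cnj (U l k)))"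
      unfolding sum_distrib_left by (subst sum.swap, rule sum.cong, simp, rule sum.swap)
    also have "\<dots> = (\<Sum>i<d. \<Sum>l<d. if l = i then cnj (U i j) * U i j else 0)"
      by (intro sum.cong) (auto simp: unitary_row[OF U])
    also have "\<dots> = of_real (c j)"
      by (simp add: c_def complex_norm_square mult.commute del: of_real_power)
    finally have "complex_of_real (\<Sum>k<d. cmod (y k) ^ 2) = of_real (c j)"
      by (simp add: complex_norm_square del: of_real_power)
    then have "(\<Sum>k<d. cmod (y k) ^ 2) = c j"
      using of_real_eq_iff by blast
    moreover have "cmod (y j) ^ 2 \<le> (\<Sum>k<d. cmod (y k) ^ 2)"
      by (rule member_le_sum) (use that in auto)
    moreover have "0 \<le> c j"
      by (simp add: c_def sum_nonneg)
    ultimately have "c j * c j \<le> 1 * c j" "0 \<le> c j"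
      by (simp_all add: yj power2_eq_square)
    then show ?thesis
      using mult_le_cancel_right[of "c j" "c j" 1] by (cases "c j = 0") auto
  qed
  have "(\<Sum>j<d. c j) = (\<Sum>i<d. \<Sum>j<d. cmod (U i j) ^ 2)"
    unfolding c_def by (rule sum.swap)
  also have "\<dots> = (\<Sum>i<d. 1)"
  proof (rule sum.cong)
    fix i assume "i \<in> {..<d}"
    then have "complex_of_real (\<Sum>j<d. cmod (U i j) ^ 2) = of_real 1"
      using unitary_row[OF U, of i i] by (simp add: complex_norm_square del: of_real_power)
    then show "(\<Sum>j<d. cmod (U i j) ^ 2) = 1"
      using of_real_eq_iff by blast
  qed simp
  finally have "(\<Sum>j<d. 1 - c j) = 0"
    by (simp add: sum_subtractf)
  then have "1 - c j = 0"
    using bessel j by (subst (asm) sum_nonneg_eq_0_iff) auto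
  then show ?thesis
    by (simp add: c_def)
qed

lemma mat_mult_unitary:
  assumes V: "V \<in> unitary_mats d" and U: "U \<in> unitary_mats d"
  shows "mat_mult d V U \<in> unitary_mats d"
proof -
  have "(\<Sum>j<d. mat_mult d V U i j * cnj (mat_mult d V U k j)) = (if i = k then 1 else 0)"
    if i: "i < d" and k: "k < d" for i k
  proof -
    have "(\<Sum>j<d. mat_mult d V U i j * cnj (mat_mult d V U k j)) =
        (\<Sum>j<d. \<Sum>a<d. \<Sum>b<d. V i a * cnj (V k b) * (U a j * cnj (U b j)))"
      using i k by (simp add: mat_mult_def sum_product mult_ac)
    also have "\<dots> = (\<Sum>a<d. \<Sum>b<d. V i a * cnj (V k b) * (\<Sum>j<d. U a j * cnj (U b j)))"
      unfolding sum_distrib_left by (subst sum.swap, rule sum.cong, simp, rule sum.swap)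
    also have "\<dots> = (\<Sum>a<d. \<Sum>b<d. if b = a then V i a * cnj (V k a) else 0)"
      by (intro sum.cong) (auto simp: unitary_row[OF U])
    also have "\<dots> = (if i = k then 1 else 0)"
      by (simp add: unitary_row[OF V i k])
    finally show ?thesis .
  qed
  then show ?thesis
    by (auto simp: unitary_mats_def mat_mult_def)
qed

text \<open>A balanced beam splitter: the phase \<open>w\<close> on coordinate \<open>y\<close>,
  followed by a Hadamard matrix on \<open>x\<close> and \<open>y\<close>, and the identity
  elsewhere.\<close>

definition pair_mixer :: "nat \<Rightarrow> nat \<Rightarrow> nat \<Rightarrow> complex \<Rightarrow> nat \<Rightarrow> nat \<Rightarrow> complex" where
  "pair_mixer d x y w = (\<lambda>i j.
     if i = x then (if j = x then 1 / of_real (sqrt 2) else if j = y then w / of_real (sqrt 2) else 0)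
     else if i = y then (if j = x then 1 / of_real (sqrt 2) else if j = y then - w / of_real (sqrt 2) else 0)
     else if i = j \<and> i < d then 1 else 0)"

lemma sum_pair_mixer:
  assumes "x < d" "y < d" "x \<noteq> y" "i < d"
  shows "(\<Sum>j<d. pair_mixer d x y w i j * f j) =
    (if i = x then (f x + w * f y) / of_real (sqrt 2) else if i = y then (f x - w * f y) / of_real (sqrt 2) else f i)"
proof -
  have "(\<Sum>j<d. pair_mixer d x y w i j * f j) =
      (\<Sum>j<d. (if j = x then pair_mixer d x y w i x * f x else 0)
        + (if j = y then pair_mixer d x y w i y * f y else 0)
        + (if j = i then (if i = x \<or> i = y then 0 else f i) else 0))"
    using assms by (intro sum.cong) (auto simp: pair_mixer_def)
  then show ?thesis
    using assms by (auto simp: sum.distrib pair_mixer_def field_simps)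
qed

lemma sqrt2_square: "complex_of_real (sqrt 2) * complex_of_real (sqrt 2) = 2"
  by (simp flip: of_real_mult)

lemma pair_mixer_unitary:
  assumes "x < d" "y < d" "x \<noteq> y" "cmod w = 1"
  shows "pair_mixer d x y w \<in> unitary_mats d"
proof -
  have w: "w * cnj w = 1"
    using assms(4) by (simp add: complex_norm_square[symmetric] del: of_real_power)
  have "(\<Sum>j<d. pair_mixer d x y w i j * cnj (pair_mixer d x y w k j)) = (if i = k then 1 else 0)"
    if "i < d" "k < d" for i k
    using assms that w sqrt2_square unfolding sum_pair_mixer[OF assms(1-3) that(1)]
    by (auto simp: pair_mixer_def field_simps)
  then show ?thesis
    using assms by (auto simp: unitary_mats_def pair_mixer_def)
qed

text \<open>By the polarisation identity the two squared moduli are replaced by their mean plus or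
  minus the interference term \<open>R\<close>.\<close>

lemma pair_mixer_mult:
  assumes "x < d" "y < d" "x \<noteq> y" "cmod w = 1" and U: "U \<in> unitary_mats d"
    and R: "R = Re (cnj (U x 0) * (w * U y 0))" and m: "m = (cmod (U x 0) ^ 2 + cmod (U y 0) ^ 2) / 2"
  shows "(\<lambda>i. cmod (mat_mult d (pair_mixer d x y w) U i 0) ^ 2) =
    (\<lambda>i. cmod (U i 0) ^ 2)(x := m + R, y := m - R)"
proof
  fix i
  have 1: "cmod ((a + b) / sqrt 2) ^ 2 = (cmod a ^ 2 + cmod b ^ 2) / 2 + Re (cnj a * b)"
    "cmod ((a - b) / sqrt 2) ^ 2 = (cmod a ^ 2 + cmod b ^ 2) / 2 - Re (cnj a * b)" for a b :: complex
    unfolding norm_divide power_divide cmod_power2 by (simp_all add: power2_eq_square field_simps)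
  have "cmod (w * U y 0) = cmod (U y 0)"
    by (simp add: norm_mult assms)
  moreover have "U i 0 = 0" if "\<not> i < d"
    using U that by (simp add: unitary_mats_def)
  ultimately show "cmod (mat_mult d (pair_mixer d x y w) U i 0) ^ 2 =
    ((\<lambda>i. cmod (U i 0) ^ 2)(x := m + R, y := m - R)) i"
    using assms(1-3) 1[of "U x 0" "w * U y 0"]
    by (auto simp: mat_mult_def sum_pair_mixer R m)
qed

subsection \<open>Moments of a Haar-random column\<close>

locale haar_measure =
  fixes d :: nat and M :: "(nat \<Rightarrow> nat \<Rightarrow> complex) measure"
  assumes haar: "haar_unitary d M"
    and d_pos: "0 < d"
begin

sublocale prob_space M
  using haar by (simp add: haar_unitary_def)

lemma space_M: "space M = unitary_mats d"
  using haar by (simp add: haar_unitary_def)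

lemma entry_measurable [measurable]: "(\<lambda>U. U i j) \<in> borel_measurable M"
proof (rule measurableI)
  fix B :: "complex set" assume "B \<in> sets borel"
  then show "(\<lambda>U. U i j) -` B \<inter> space M \<in> sets M"
    using haar unfolding haar_unitary_def unitary_sets_def
    by (auto intro!: sigma_sets.Basic)
qed simp

lemma mult_measurable:
  assumes "V \<in> unitary_mats d"
  shows "mat_mult d V \<in> M \<rightarrow>\<^sub>M M"
  using assms haar by (auto intro!: measurableI mat_mult_unitary simp: haar_unitary_def)

text \<open>Left invariance as an equality of image measures, the form in which it transfers to
  integrals.\<close>

lemma distr_mult:
  assumes V: "V \<in> unitary_mats d"
  shows "distr M M (mat_mult d V) = M"
proof (rule measure_eqI)
  fix A assume "A \<in> sets (distr M M (mat_mult d V))"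
  then have A: "A \<in> sets M"
    by simp
  have "emeasure M (mat_mult d V -` A \<inter> space M) = emeasure M A"
    using haar V A unfolding haar_unitary_def by blast
  then show "emeasure (distr M M (mat_mult d V)) A = emeasure M A"
    by (simp add: emeasure_distr[OF mult_measurable[OF V] A])
qed simp

section \<open>Bounded measurable functions of the random column\<close>

definition col :: "(nat \<Rightarrow> nat \<Rightarrow> complex) \<Rightarrow> nat \<Rightarrow> real" where
  "col U x = cmod (U x 0) ^ 2"

text \<open>Unlike integrability, this property is closed under products, so the simplifier can
  discharge integrability of polynomials in the column entries.\<close>

definition bounded_measurable :: "((nat \<Rightarrow> nat \<Rightarrow> complex) \<Rightarrow> real) \<Rightarrow> bool" where
  "bounded_measurable f \<longleftrightarrow> f \<in> borel_measurable M \<and> (\<exists>B. \<forall>U\<in>space M. \<bar>f U\<bar> \<le> B)"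

lemma bounded_measurable_integrable [simp]: "bounded_measurable f \<Longrightarrow> integrable M f"
  unfolding bounded_measurable_def by (auto intro!: integrable_const_bound AE_I2)

lemma bounded_measurable_const [simp]: "bounded_measurable (\<lambda>U. c)"
  by (auto simp: bounded_measurable_def)

lemma bounded_measurable_add [simp]:
  assumes "bounded_measurable f" "bounded_measurable g"
  shows "bounded_measurable (\<lambda>U. f U + g U)"
proof -
  obtain B C where "\<forall>U\<in>space M. \<bar>f U\<bar> \<le> B" "\<forall>U\<in>space M. \<bar>g U\<bar> \<le> C"
    using assms by (auto simp: bounded_measurable_def)
  then have "\<forall>U\<in>space M. \<bar>f U + g U\<bar> \<le> B + C"
    by (fastforce intro: order_trans[OF abs_triangle_ineq])
  then show ?thesis
    using assms by (auto simp: bounded_measurable_def)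
qed

lemma bounded_measurable_mult [simp]:
  assumes "bounded_measurable f" "bounded_measurable g"
  shows "bounded_measurable (\<lambda>U. f U * g U)"
proof -
  obtain B C where "\<forall>U\<in>space M. \<bar>f U\<bar> \<le> B" "\<forall>U\<in>space M. \<bar>g U\<bar> \<le> C"
    using assms by (auto simp: bounded_measurable_def)
  then have "\<forall>U\<in>space M. \<bar>f U * g U\<bar> \<le> B * C"
    by (auto simp: abs_mult intro!: mult_mono order_trans[OF abs_ge_zero])
  then show ?thesis
    using assms by (auto simp: bounded_measurable_def)
qed

lemma bounded_measurable_diff [simp]:
  assumes "bounded_measurable f" "bounded_measurable g"
  shows "bounded_measurable (\<lambda>U. f U - g U)"
  using bounded_measurable_add[OF assms(1)
      bounded_measurable_mult[OF bounded_measurable_const[of "-1"] assms(2)]] by simp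

lemma bounded_measurable_divide [simp]:
  assumes "bounded_measurable f"
  shows "bounded_measurable (\<lambda>U. f U / c)"
  using bounded_measurable_mult[OF assms bounded_measurable_const[of "1 / c"]] by simp

lemma bounded_measurable_power [simp]:
  "bounded_measurable f \<Longrightarrow> bounded_measurable (\<lambda>U. f U ^ n)"
  by (induction n) simp_all

lemma bounded_measurable_sum [simp]:
  "(\<And>i. i \<in> I \<Longrightarrow> bounded_measurable (f i)) \<Longrightarrow> bounded_measurable (\<lambda>U. \<Sum>i\<in>I. f i U)"
  by (induction I rule: infinite_finite_induct) simp_all

lemma sum_col: "U \<in> space M \<Longrightarrow> (\<Sum>x<d. col U x) = 1"
  using unitary_column[of U d 0] d_pos by (simp add: space_M col_def)

lemma col_outside: "U \<in> space M \<Longrightarrow> d \<le> x \<Longrightarrow> col U x = 0"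
  by (simp add: space_M col_def unitary_mats_def)

lemma col_nonneg [simp]: "0 \<le> col U x"
  by (simp add: col_def)

lemma col_le_1:
  assumes "U \<in> space M"
  shows "col U x \<le> 1"
proof (cases "x < d")
  case True
  then have "col U x \<le> (\<Sum>x<d. col U x)"
    by (intro member_le_sum) auto
  then show ?thesis
    using sum_col[OF assms] by simp
qed (use col_outside[OF assms, of x] in simp)

lemma bounded_measurable_col [simp]: "bounded_measurable (\<lambda>U. col U x)"
  unfolding bounded_measurable_def using col_le_1
  by (auto simp: col_def intro!: exI[of _ 1])

section \<open>Invariance of the column under mixing two rows\<close>

definition cross :: "complex \<Rightarrow> nat \<Rightarrow> nat \<Rightarrow> (nat \<Rightarrow> nat \<Rightarrow> complex) \<Rightarrow> real" where
  "cross w x y U = Re (cnj (U x 0) * (w * U y 0))"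

text \<open>The action of \<open>pair_mixer\<close> on squared moduli. The interference
  \<open>R\<close> is a separate argument because it depends on phases that \<open>v\<close> does
  not record.\<close>

definition mix :: "nat \<Rightarrow> nat \<Rightarrow> real \<Rightarrow> (nat \<Rightarrow> real) \<Rightarrow> nat \<Rightarrow> real" where
  "mix x y R v = v(x := (v x + v y) / 2 + R, y := (v x + v y) / 2 - R)"

lemma mix_apply:
  assumes "x \<noteq> y"
  shows "mix x y R v x = (v x + v y) / 2 + R" "mix x y R v y = (v x + v y) / 2 - R"
    "z \<noteq> x \<Longrightarrow> z \<noteq> y \<Longrightarrow> mix x y R v z = v z"
  using assms by (simp_all add: mix_def)

lemma integral_mix:
  fixes F :: "(nat \<Rightarrow> real) \<Rightarrow> real"
  assumes xy: "x < d" "y < d" "x \<noteq> y" and w: "cmod w = 1"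
    and F: "integrable M (\<lambda>U. F (col U))"
  shows "integrable M (\<lambda>U. F (mix x y (cross w x y U) (col U)))"
    and "(\<integral>U. F (mix x y (cross w x y U) (col U)) \<partial>M) = (\<integral>U. F (col U) \<partial>M)"
proof -
  let ?V = "pair_mixer d x y w"
  have V: "?V \<in> unitary_mats d"
    using pair_mixer_unitary[OF xy w] .
  have col: "col (mat_mult d ?V U) = mix x y (cross w x y U) (col U)" if "U \<in> space M" for U
    using pair_mixer_mult[OF xy w, of U _ _] that
    by (simp add: col_def[abs_def] mix_def cross_def space_M)
  have "integrable (distr M M (mat_mult d ?V)) (\<lambda>U. F (col U))"
    using F by (simp add: distr_mult[OF V])
  then have "integrable M (\<lambda>U. F (col (mat_mult d ?V U)))"
    by (rule integrable_distr[OF mult_measurable[OF V]])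
  then show "integrable M (\<lambda>U. F (mix x y (cross w x y U) (col U)))"
    by (rule Bochner_Integration.integrable_cong[THEN iffD1, rotated -1]) (simp_all add: col)
  have "(\<integral>U. F (col U) \<partial>M) = (\<integral>U. F (col U) \<partial>distr M M (mat_mult d ?V))"
    by (simp add: distr_mult[OF V])
  also have "\<dots> = (\<integral>U. F (col (mat_mult d ?V U)) \<partial>M)"
    using F by (intro integral_distr mult_measurable[OF V] borel_measurable_integrable)
  also have "\<dots> = (\<integral>U. F (mix x y (cross w x y U) (col U)) \<partial>M)"
    by (rule Bochner_Integration.integral_cong) (simp_all add: col)
  finally show "(\<integral>U. F (mix x y (cross w x y U) (col U)) \<partial>M) = (\<integral>U. F (col U) \<partial>M)"
    by simp
qed

text \<open>Changing the phase from 1 to -1 flips the interference term, which exchanges the two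
  mixed entries; two applications of \<open>integral_mix\<close> thus yield exchangeability.\<close>

lemma integral_swap:
  fixes F :: "(nat \<Rightarrow> real) \<Rightarrow> real"
  assumes xy: "x < d" "y < d" "x \<noteq> y"
    and F: "integrable M (\<lambda>U. F (col U))" "integrable M (\<lambda>U. F ((col U)(x := col U y, y := col U x)))"
  shows "(\<integral>U. F ((col U)(x := col U y, y := col U x)) \<partial>M) = (\<integral>U. F (col U) \<partial>M)"
proof -
  let ?H = "\<lambda>v. F (v(x := v y, y := v x))"
  have H: "?H (mix x y (cross 1 x y U) v) = F (mix x y (cross (-1) x y U) v)" for U v
    using xy by (intro arg_cong[of _ _ F]) (auto simp: mix_def cross_def)
  have "(\<integral>U. ?H (col U) \<partial>M) = (\<integral>U. ?H (mix x y (cross 1 x y U) (col U)) \<partial>M)"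
    using integral_mix(2)[OF xy, of 1 ?H] F by simp
  also have "\<dots> = (\<integral>U. F (col U) \<partial>M)"
    unfolding H using integral_mix(2)[OF xy, of "-1" F] F by simp
  finally show ?thesis .
qed

text \<open>Averaging over the three cube roots of unity as relative phases is enough to kill the
  phase dependence of the second and fourth powers of the cross term.\<close>
lemma integral_mix_even:
  fixes F :: "(nat \<Rightarrow> real) \<Rightarrow> real"
  assumes xy: "x < d" "y < d" "x \<noteq> y"
    and F: "integrable M (\<lambda>U. F (col U))"
    and mix: "\<And>v R. F (mix x y R v) = a v + b v * R ^ 2 + c v * R ^ 4"
  shows "(\<integral>U. F (col U) \<partial>M) =
    (\<integral>U. a (col U) + b (col U) * (col U x * col U y) / 2
        + c (col U) * (3 / 8 * (col U x * col U y) ^ 2) \<partial>M)"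
proof -
  define w1 where "w1 = Complex (- 1 / 2) (sqrt 3 / 2)"
  define w2 where "w2 = Complex (- 1 / 2) (- sqrt 3 / 2)"
  have w: "cmod w1 = 1" "cmod w2 = 1"
    by (simp_all add: w1_def w2_def complex_norm power_divide)
  define G where "G w U = F (mix x y (cross w x y U) (col U))" for w U
  have int: "integrable M (G 1)" "integrable M (G w1)" "integrable M (G w2)"
    and eq: "(\<integral>U. G 1 U \<partial>M) = (\<integral>U. F (col U) \<partial>M)" "(\<integral>U. G w1 U \<partial>M) = (\<integral>U. F (col U) \<partial>M)"
      "(\<integral>U. G w2 U \<partial>M) = (\<integral>U. F (col U) \<partial>M)"
    unfolding G_def using integral_mix[OF xy _ F] w by simp_all
  \<comment> \<open>The three linear forms are the real parts of \<open>z\<close>,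
    \<open>w1 * z\<close> and \<open>w2 * z\<close> for \<open>z\<close> with real part
    \<open>r\<close> and imaginary part \<open>i\<close>.\<close>
  have cube: "r ^ 2 + (- r / 2 - sqrt 3 / 2 * i) ^ 2 + (- r / 2 + sqrt 3 / 2 * i) ^ 2
        = 3 / 2 * (r ^ 2 + i ^ 2)"
      "r ^ 4 + (- r / 2 - sqrt 3 / 2 * i) ^ 4 + (- r / 2 + sqrt 3 / 2 * i) ^ 4
        = 9 / 8 * (r ^ 2 + i ^ 2) ^ 2" for r i :: real
  proof -
    have q: "sqrt 3 * sqrt 3 = (3::real)" "sqrt 3 * (sqrt 3 * z) = 3 * z" for z :: real
      by (simp_all flip: mult.assoc)
    show "r ^ 2 + (- r / 2 - sqrt 3 / 2 * i) ^ 2 + (- r / 2 + sqrt 3 / 2 * i) ^ 2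
        = 3 / 2 * (r ^ 2 + i ^ 2)"
      by (simp add: power2_eq_square algebra_simps q)
    show "r ^ 4 + (- r / 2 - sqrt 3 / 2 * i) ^ 4 + (- r / 2 + sqrt 3 / 2 * i) ^ 4
        = 9 / 8 * (r ^ 2 + i ^ 2) ^ 2"
    proof -
      define t where "t = sqrt 3 / 2 * i"
      have t: "t ^ 2 = 3 / 4 * i ^ 2"
        by (simp add: t_def power2_eq_square q)
      have "r ^ 4 + (- r / 2 - t) ^ 4 + (- r / 2 + t) ^ 4 =
          9 / 8 * r ^ 4 + 3 * r ^ 2 * t ^ 2 + 2 * (t ^ 2) ^ 2"
        by (simp add: power4_eq_xxxx power2_eq_square field_simps)
      also have "\<dots> = 9 / 8 * (r ^ 2 + i ^ 2) ^ 2"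
        unfolding t by (simp add: power4_eq_xxxx power2_eq_square field_simps)
      finally show ?thesis
        by (simp add: t_def)
    qed
  qed
  have avg: "cross 1 x y U ^ 2 + cross w1 x y U ^ 2 + cross w2 x y U ^ 2 = 3 / 2 * (col U x * col U y)"
    "cross 1 x y U ^ 4 + cross w1 x y U ^ 4 + cross w2 x y U ^ 4 = 9 / 8 * (col U x * col U y) ^ 2" for U
  proof -
    define z where "z = cnj (U x 0) * U y 0"
    have z: "col U x * col U y = Re z ^ 2 + Im z ^ 2"
      unfolding col_def cmod_power2 by (simp add: z_def power2_eq_square algebra_simps)
    have cr: "cross 1 x y U = Re z" "cross w1 x y U = - Re z / 2 - sqrt 3 / 2 * Im z"
      "cross w2 x y U = - Re z / 2 + sqrt 3 / 2 * Im z"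
      by (simp_all add: cross_def z_def w1_def w2_def field_simps)
    show "cross 1 x y U ^ 2 + cross w1 x y U ^ 2 + cross w2 x y U ^ 2 = 3 / 2 * (col U x * col U y)"
      "cross 1 x y U ^ 4 + cross w1 x y U ^ 4 + cross w2 x y U ^ 4 = 9 / 8 * (col U x * col U y) ^ 2"
      unfolding z cr by (rule cube)+
  qed
  \<comment> \<open>Division by 3 turns 3/2 and 9/8 into 1/2 and 3/8, the averages of the second and
    fourth powers of the cosine over a full circle.\<close>
  have "(\<integral>U. F (col U) \<partial>M) = (\<integral>U. (G 1 U + G w1 U + G w2 U) / 3 \<partial>M)"
    using int eq by simp
  also have "\<dots> = (\<integral>U. a (col U) + b (col U) * (col U x * col U y) / 2
        + c (col U) * (3 / 8 * (col U x * col U y) ^ 2) \<partial>M)"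
  proof (rule Bochner_Integration.integral_cong[OF refl])
    fix U
    have "(G 1 U + G w1 U + G w2 U) / 3 =
        a (col U) + b (col U) * (cross 1 x y U ^ 2 + cross w1 x y U ^ 2 + cross w2 x y U ^ 2) / 3
        + c (col U) * (cross 1 x y U ^ 4 + cross w1 x y U ^ 4 + cross w2 x y U ^ 4) / 3"
      by (simp add: G_def mix field_simps)
    then show "(G 1 U + G w1 U + G w2 U) / 3 = a (col U) + b (col U) * (col U x * col U y) / 2
        + c (col U) * (3 / 8 * (col U x * col U y) ^ 2)"
      unfolding avg by simp
  qed
  finally show ?thesis .
qed

lemma integral_product_pair:
  assumes xy: "x < d" "y < d" "x \<noteq> y"
    and g: "bounded_measurable (\<lambda>U. g (col U))" "\<And>v R. g (mix x y R v) = g v"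
  shows "(\<integral>U. g (col U) * (col U x * col U y) \<partial>M) =
    ((\<integral>U. g (col U) * col U x ^ 2 \<partial>M) + (\<integral>U. g (col U) * col U y ^ 2 \<partial>M)) / 4"
proof -
  have "(\<integral>U. g (col U) * (col U x * col U y) \<partial>M) =
      (\<integral>U. g (col U) * ((col U x + col U y) / 2) ^ 2 + (- g (col U)) * (col U x * col U y) / 2
        + 0 * (3 / 8 * (col U x * col U y) ^ 2) \<partial>M)"
    by (rule integral_mix_even[OF xy, where F = "\<lambda>v. g v * (v x * v y)"
          and a = "\<lambda>v. g v * ((v x + v y) / 2) ^ 2" and b = "\<lambda>v. - g v" and c = "\<lambda>v. 0"])
       (use g xy in \<open>auto simp: mix_def power2_eq_square algebra_simps\<close>)
  \<comment> \<open>The product contained in the squared mean cancels against the averaged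
    interference, leaving only pure squares.\<close>
  also have "\<dots> = (\<integral>U. 1 / 4 * (g (col U) * col U x ^ 2) + 1 / 4 * (g (col U) * col U y ^ 2) \<partial>M)"
    by (rule Bochner_Integration.integral_cong) (auto simp: power2_eq_square field_simps)
  finally show ?thesis
    using g by simp
qed

text \<open>The exponent \<open>b = 0\<close> gives that all entries have equal pure
  moments.\<close>

lemma moment_swap:
  assumes xy: "x < d" "y < d"
  shows "(\<integral>U. col U y ^ a * col U x ^ b \<partial>M) = (\<integral>U. col U x ^ a * col U y ^ b \<partial>M)"
proof (cases "x = y")
  case False
  then show ?thesis
    using integral_swap[OF xy False, of "\<lambda>v. v x ^ a * v y ^ b"] by simp
qed simp

section \<open>Second moments\<close>

lemma second_moment_mixed:
  assumes xy: "x < d" "y < d" "x \<noteq> y"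
  shows "(\<integral>U. col U x * col U y \<partial>M) = (\<integral>U. col U x ^ 2 \<partial>M) / 2"
  using integral_product_pair[OF xy, of "\<lambda>v. 1"] moment_swap[OF xy(1,2), of 2 0] by simp

lemma second_moment:
  assumes x: "x < d"
  shows "(\<integral>U. col U x ^ 2 \<partial>M) = 2 / (d * (real d + 1))"
proof -
  define A where "A = (\<integral>U. col U x ^ 2 \<partial>M)"
  have A: "(\<integral>U. col U y * col U z \<partial>M) = A / 2 + (if z = y then A / 2 else 0)"
    if "y < d" "z < d" for y z
  proof -
    have y: "(\<integral>U. col U y ^ 2 \<partial>M) = A"
      using moment_swap[OF x that(1), of 2 0] by (simp add: A_def)
    then show ?thesis
      using second_moment_mixed[OF that] by (auto simp: power2_eq_square)
  qed
  \<comment> \<open>Expanding the square of the total mass 1 gives \<open>d\<close> terms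
    \<open>A\<close> and \<open>d * (d - 1)\<close> terms \<open>A / 2\<close>, which determines
    \<open>A\<close>.\<close>
  have "1 = (\<integral>U. (1 :: real) \<partial>M)"
    using prob_space by simp
  also have "\<dots> = (\<integral>U. (\<Sum>y<d. \<Sum>z<d. col U y * col U z) \<partial>M)"
    by (rule Bochner_Integration.integral_cong) (simp_all add: sum_col flip: sum_product)
  also have "\<dots> = (\<Sum>y<d. \<Sum>z<d. \<integral>U. col U y * col U z \<partial>M)"
    by (simp add: Bochner_Integration.integral_sum)
  also have "\<dots> = (\<Sum>y<d. \<Sum>z<d. A / 2 + (if z = y then A / 2 else 0))"
    by (intro sum.cong) (simp_all add: A)
  also have "\<dots> = A * (d * (real d + 1)) / 2"
    unfolding sum.distrib by (simp add: field_simps)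
  finally have "A * (d * (real d + 1)) = 2"
    by simp
  then show ?thesis
    unfolding A_def using d_pos by (subst nonzero_eq_divide_eq) auto
qed

section \<open>Fourth moments\<close>

lemma fourth_moment_22:
  assumes xy: "x < d" "y < d" "x \<noteq> y"
  shows "(\<integral>U. col U x ^ 2 * col U y ^ 2 \<partial>M) = (\<integral>U. col U x ^ 4 \<partial>M) / 6"
proof -
  define A D where "A = (\<integral>U. col U x ^ 4 \<partial>M)" and "D = (\<integral>U. col U x ^ 2 * col U y ^ 2 \<partial>M)"
  have A: "(\<integral>U. col U y ^ 4 \<partial>M) = A"
    using moment_swap[OF xy(1,2), of 4 0] by (simp add: A_def)
  \<comment> \<open>With \<open>m\<close> the mean of the two entries, the mixed product is
    \<open>(m^2 - R^2)^2\<close>. Averaging gives the linear equation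
    \<open>D = A / 8 + D / 4\<close>.\<close>
  have "D = (\<integral>U. ((col U x + col U y) / 2) ^ 4
        + (- 2 * ((col U x + col U y) / 2) ^ 2) * (col U x * col U y) / 2
        + 1 * (3 / 8 * (col U x * col U y) ^ 2) \<partial>M)"
    unfolding D_def
    by (rule integral_mix_even[OF xy, where F = "\<lambda>v. v x ^ 2 * v y ^ 2"
          and a = "\<lambda>v. ((v x + v y) / 2) ^ 4" and b = "\<lambda>v. - 2 * ((v x + v y) / 2) ^ 2"
          and c = "\<lambda>v. 1"])
       (auto simp: mix_apply[OF xy(3)] power4_eq_xxxx power2_eq_square field_simps)
  also have "\<dots> = (\<integral>U. 1 / 16 * col U x ^ 4 + 1 / 16 * col U y ^ 4
        + 1 / 4 * (col U x ^ 2 * col U y ^ 2) \<partial>M)"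
    by (rule Bochner_Integration.integral_cong)
       (auto simp: power4_eq_xxxx power2_eq_square field_simps)
  also have "\<dots> = 1 / 16 * A + 1 / 16 * A + 1 / 4 * D"
    by (simp add: A A_def[symmetric] D_def[symmetric])
  finally show ?thesis
    unfolding A_def[symmetric] D_def[symmetric] by simp
qed

text \<open>The sum of the two entries is invariant under mixing, so its square is an admissible
  weight; expanding gives a linear equation between the moments of types 4, 31 and 22.\<close>

lemma fourth_moment_31:
  assumes xy: "x < d" "y < d" "x \<noteq> y"
  shows "(\<integral>U. col U x ^ 3 * col U y \<partial>M) = (\<integral>U. col U x ^ 4 \<partial>M) / 4"
proof -
  define A B D where "A = (\<integral>U. col U x ^ 4 \<partial>M)" and "B = (\<integral>U. col U x ^ 3 * col U y \<partial>M)"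
    and "D = (\<integral>U. col U x ^ 2 * col U y ^ 2 \<partial>M)"
  have A: "(\<integral>U. col U y ^ 4 \<partial>M) = A"
    using moment_swap[OF xy(1,2), of 4 0] by (simp add: A_def)
  have B: "(\<integral>U. col U x * col U y ^ 3 \<partial>M) = B"
    using moment_swap[OF xy(1,2), of 3 1] by (simp add: B_def mult.commute)
  have "(\<integral>U. (col U x + col U y) ^ 2 * (col U x * col U y) \<partial>M) =
      ((\<integral>U. (col U x + col U y) ^ 2 * col U x ^ 2 \<partial>M)
        + (\<integral>U. (col U x + col U y) ^ 2 * col U y ^ 2 \<partial>M)) / 4"
    by (rule integral_product_pair[OF xy, of "\<lambda>v. (v x + v y) ^ 2"])
       (simp_all add: mix_apply[OF xy(3)])
  moreover have "(\<integral>U. (col U x + col U y) ^ 2 * (col U x * col U y) \<partial>M) =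
      (\<integral>U. col U x ^ 3 * col U y + 2 * (col U x ^ 2 * col U y ^ 2) + col U x * col U y ^ 3 \<partial>M)"
    by (rule Bochner_Integration.integral_cong)
       (auto simp: power3_eq_cube power2_eq_square algebra_simps)
  moreover have "(\<integral>U. (col U x + col U y) ^ 2 * col U x ^ 2 \<partial>M) =
      (\<integral>U. col U x ^ 4 + 2 * (col U x ^ 3 * col U y) + col U x ^ 2 * col U y ^ 2 \<partial>M)"
    by (rule Bochner_Integration.integral_cong)
       (auto simp: power4_eq_xxxx power3_eq_cube power2_eq_square algebra_simps)
  moreover have "(\<integral>U. (col U x + col U y) ^ 2 * col U y ^ 2 \<partial>M) =
      (\<integral>U. col U y ^ 4 + 2 * (col U x * col U y ^ 3) + col U x ^ 2 * col U y ^ 2 \<partial>M)"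
    by (rule Bochner_Integration.integral_cong)
       (auto simp: power4_eq_xxxx power3_eq_cube power2_eq_square algebra_simps)
  ultimately have "B + 2 * D + B = ((A + 2 * B + D) + (A + 2 * B + D)) / 4"
    by (simp add: A B A_def[symmetric] B_def[symmetric] D_def[symmetric])
  moreover have "D = A / 6"
    unfolding A_def D_def by (rule fourth_moment_22[OF xy])
  ultimately show ?thesis
    unfolding A_def[symmetric] B_def[symmetric] by simp
qed

text \<open>Mixing \<open>y\<close> and \<open>z\<close> leaves entry \<open>x\<close> alone, so its
  square may serve as the weight and the claim reduces to type 22.\<close>

lemma fourth_moment_211:
  assumes xyz: "x < d" "y < d" "z < d" "x \<noteq> y" "x \<noteq> z" "y \<noteq> z"
  shows "(\<integral>U. col U x ^ 2 * (col U y * col U z) \<partial>M) = (\<integral>U. col U x ^ 4 \<partial>M) / 12"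
  using integral_product_pair[OF xyz(2,3,6), of "\<lambda>v. v x ^ 2"] xyz
    fourth_moment_22[OF xyz(1,2,4)] fourth_moment_22[OF xyz(1,3,5)]
  by (simp add: mix_apply)

text \<open>Multiplying the second moment by the squared total mass 1 relates it to fourth moments
  that repeat index \<open>x\<close>, so four distinct indices never occur.\<close>

lemma fourth_moment:
  assumes x: "x < d"
  shows "(\<integral>U. col U x ^ 4 \<partial>M) = 24 / (d * (real d + 1) * (real d + 2) * (real d + 3))"
proof -
  define A where "A = (\<integral>U. col U x ^ 4 \<partial>M)"
  \<comment> \<open>One formula for all coincidence patterns, built from indicators so that the
    double sum evaluates to \<open>d^2 + 5 * d + 6\<close>, that is
    \<open>(d + 2) * (d + 3)\<close>.\<close>
  have A: "(\<integral>U. col U x ^ 2 * (col U y * col U z) \<partial>M) =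
      A / 12 * (1 + (if y = x then 2 else 0) + (if z = x then 2 else 0) + (if z = y then 1 else 0)
        + (if z = x then if y = x then 6 else 0 else 0))"
    if y: "y < d" and z: "z < d" for y z
  proof -
    consider "y = x" "z = x" | "y = x" "z \<noteq> x" | "y \<noteq> x" "z = x" | "y \<noteq> x" "z = y"
      | "y \<noteq> x" "z \<noteq> x" "z \<noteq> y" by blast
    then show ?thesis
    proof cases
      case 1
      then show ?thesis
        by (simp add: A_def power2_eq_square power4_eq_xxxx mult.assoc)
    next
      case 2
      then show ?thesis
        using fourth_moment_31[OF x z] by (simp add: A_def power2_eq_square power3_eq_cube mult_ac)
    next
      case 3
      then show ?thesis
        using fourth_moment_31[OF x y] by (simp add: A_def power2_eq_square power3_eq_cube mult_ac)
    next
      case 4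
      then show ?thesis
        using fourth_moment_22[OF x y] by (simp add: A_def power2_eq_square mult_ac)
    next
      case 5
      then show ?thesis
        using fourth_moment_211[OF x y z] by (simp add: A_def)
    qed
  qed
  have "2 / (d * (real d + 1)) = (\<integral>U. col U x ^ 2 \<partial>M)"
    by (simp add: second_moment[OF x])
  also have "\<dots> = (\<integral>U. col U x ^ 2 * ((\<Sum>y<d. col U y) * (\<Sum>z<d. col U z)) \<partial>M)"
    by (rule Bochner_Integration.integral_cong) (simp_all add: sum_col)
  also have "\<dots> = (\<integral>U. (\<Sum>y<d. \<Sum>z<d. col U x ^ 2 * (col U y * col U z)) \<partial>M)"
    unfolding sum_product unfolding sum_distrib_left ..
  also have "\<dots> = (\<Sum>y<d. \<Sum>z<d. \<integral>U. col U x ^ 2 * (col U y * col U z) \<partial>M)"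
    by (subst Bochner_Integration.integral_sum, simp)
       (intro sum.cong refl Bochner_Integration.integral_sum, simp)
  also have "\<dots> = (\<Sum>y<d. \<Sum>z<d. A / 12 * (1 + (if y = x then 2 else 0) + (if z = x then 2 else 0)
        + (if z = y then 1 else 0) + (if z = x then if y = x then 6 else 0 else 0)))"
    by (intro sum.cong refl A) simp_all
  also have "\<dots> = A / 12 * ((real d + 2) * (real d + 3))"
    unfolding sum_distrib_left[symmetric] sum.distrib using x
    by (simp add: algebra_simps flip: sum_distrib_left)
  finally have eq: "2 / (d * (real d + 1)) = A / 12 * ((real d + 2) * (real d + 3))" .
  have "A * (d * (real d + 1) * (real d + 2) * (real d + 3)) =
      12 * (A / 12 * ((real d + 2) * (real d + 3))) * (d * (real d + 1))"
    by simp
  also have "\<dots> = 24"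
    unfolding eq[symmetric] using d_pos by simp
  finally show ?thesis
    unfolding A_def using d_pos by (subst nonzero_eq_divide_eq) auto
qed

section \<open>Moments of the purity, the collision probability of the random column\<close>

definition purity :: "(nat \<Rightarrow> nat \<Rightarrow> complex) \<Rightarrow> real" where
  "purity U = (\<Sum>x<d. col U x ^ 2)"

lemma bounded_measurable_purity [simp]: "bounded_measurable purity"
  unfolding purity_def[abs_def] by simp

lemma mean_purity: "(\<integral>U. purity U \<partial>M) = 2 / (real d + 1)"
  using d_pos by (simp add: purity_def Bochner_Integration.integral_sum second_moment)

lemma mean_purity_square:
  "(\<integral>U. purity U ^ 2 \<partial>M) = 4 * (real d + 5) / ((real d + 1) * (real d + 2) * (real d + 3))"
proof -
  define A where "A = 24 / (d * (real d + 1) * (real d + 2) * (real d + 3))"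
  have "(\<integral>U. purity U ^ 2 \<partial>M) = (\<integral>U. (\<Sum>x<d. \<Sum>y<d. col U x ^ 2 * col U y ^ 2) \<partial>M)"
    by (simp add: purity_def power2_eq_square sum_product)
  also have "\<dots> = (\<Sum>x<d. \<Sum>y<d. \<integral>U. col U x ^ 2 * col U y ^ 2 \<partial>M)"
    by (simp add: Bochner_Integration.integral_sum)
  also have "\<dots> = (\<Sum>x<d. \<Sum>y<d. A / 6 + (if y = x then 5 * A / 6 else 0))"
  proof (intro sum.cong refl)
    fix x y assume xy: "x \<in> {..<d}" "y \<in> {..<d}"
    show "(\<integral>U. col U x ^ 2 * col U y ^ 2 \<partial>M) = A / 6 + (if y = x then 5 * A / 6 else 0)"
    proof (cases "y = x")
      case True
      then show ?thesis
        using fourth_moment[of x] xy by (simp add: A_def flip: power_add)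
    next
      case False
      then show ?thesis
        using fourth_moment_22[of x y] fourth_moment[of x] xy by (simp add: A_def)
    qed
  qed
  also have "\<dots> = A / 6 * (d * (real d + 5))"
    unfolding sum.distrib by (simp add: field_simps)
  finally show ?thesis
    using d_pos by (simp add: A_def)
qed

end

subsection \<open>Error probabilities\<close>

text \<open>\<open>G\<close> is the gap between the mean purity \<open>2 / (D + 1)\<close> and
  \<open>1 / D\<close>. The variance is at most \<open>0.8 * G^2\<close> and the mean exceeds
  \<open>1.02 / D\<close> by at least \<open>0.94 * G\<close>; 0.85 approximates the quotient
  0.8/0.94, the best offset for the quadratic bound.\<close>

lemma purity_variance_arith:
  fixes D :: real
  assumes D: "2 \<le> D" and G: "G = (D - 1) / (D * (D + 1))" and b: "b = 2 / (D + 1) + 0.85 * G"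
  shows "1.02 / D < b"
    and "4 * (D + 5) / ((D + 1) * (D + 2) * (D + 3)) - 2 * b * (2 / (D + 1)) + b ^ 2
      \<le> 0.48 * (b - 1.02 / D) ^ 2"
proof -
  define m where "m = 2 / (D + 1)"
  have G0: "0 < G"
    using D by (simp add: G)
  have m: "m = 1 / D + G"
  proof -
    have "D \<noteq> 0" "D + 1 \<noteq> 0"
      using D by auto
    then show ?thesis
      by (simp add: m_def G divide_simps)
  qed
  have "1 / D = (D + 1) / (D * (D + 1))"
    using D by simp
  also have "\<dots> \<le> 3 * (D - 1) / (D * (D + 1))"
    using D by (intro divide_right_mono) auto
  finally have "1 / D \<le> 3 * G"
    by (simp add: G)
  \<comment> \<open>Here 1.79 is 1.85 minus 0.06, as \<open>0.02 / D \<le> 0.06 * G\<close>.\<close>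
  then have gap: "1.79 * G \<le> b - 1.02 / D"
    by (simp add: b m flip: m_def)
  then show "1.02 / D < b"
    using G0 by simp
  \<comment> \<open>The variance bound with denominators cleared. Equality holds at
    \<open>D = 2\<close>, which is where the factor 0.8 comes from.\<close>
  have "5 * D ^ 2 \<le> (D - 1) * ((D + 2) * (D + 3))"
  proof -
    have "0 \<le> (D - 2) * (D * (D + 1) + 3)"
      using D by simp
    then show ?thesis
      by (simp add: power2_eq_square algebra_simps)
  qed
  then have X: "5 * D ^ 2 * (1 / ((D + 2) * (D + 3))) \<le> D - 1"
    using D by (simp add: pos_divide_le_eq)
  define h where "h = (D - 1) / (D ^ 2 * (D + 1) ^ 2)"
  have "4 * (D - 1) / ((D + 1) ^ 2 * ((D + 2) * (D + 3))) =
      0.8 * (h * (5 * D ^ 2 * (1 / ((D + 2) * (D + 3)))))"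
  proof -
    have "4 * k / (Z * X) = 0.8 * (k / (D ^ 2 * Z) * (5 * D ^ 2 * (1 / X)))" for k Z X :: real
      using D by simp
    then show ?thesis
      unfolding h_def .
  qed
  also have "\<dots> \<le> 0.8 * (h * (D - 1))"
    using D by (intro mult_left_mono X) (auto simp: h_def)
  also have "h * (D - 1) = G ^ 2"
    by (simp add: h_def G power_divide power_mult_distrib power2_eq_square)
  finally have "4 * (D - 1) / ((D + 1) ^ 2 * ((D + 2) * (D + 3))) \<le> 0.8 * G ^ 2" .
  moreover have "4 * (D + 5) / ((D + 1) * (D + 2) * (D + 3)) - m ^ 2 =
      4 * (D - 1) / ((D + 1) ^ 2 * ((D + 2) * (D + 3)))"
  proof -
    have "D + 1 \<noteq> 0" "D + 2 \<noteq> 0" "D + 3 \<noteq> 0"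
      using D by auto
    then show ?thesis
      by (simp add: m_def power_divide divide_simps) (simp add: power2_eq_square algebra_simps)
  qed
  ultimately have var: "4 * (D + 5) / ((D + 1) * (D + 2) * (D + 3)) - m ^ 2 \<le> 0.8 * G ^ 2"
    by (simp only:)
  have "4 * (D + 5) / ((D + 1) * (D + 2) * (D + 3)) - 2 * b * m + b ^ 2 =
      (4 * (D + 5) / ((D + 1) * (D + 2) * (D + 3)) - m ^ 2) + (b - m) ^ 2"
    by (simp add: power2_diff)
  also have "\<dots> \<le> 0.8 * G ^ 2 + (0.85 * G) ^ 2"
    by (rule add_mono[OF var]) (simp add: b m_def)
  also have "\<dots> = 1.5225 * G ^ 2"
    by (simp add: power_mult_distrib power2_eq_square)
  also have "\<dots> \<le> 0.48 * (1.79 * G) ^ 2"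
    by (simp add: power_mult_distrib power2_eq_square)
  also have "\<dots> \<le> 0.48 * (b - 1.02 / D) ^ 2"
    using gap G0 by (intro mult_left_mono power_mono) auto
  finally show "4 * (D + 5) / ((D + 1) * (D + 2) * (D + 3)) - 2 * b * (2 / (D + 1)) + b ^ 2
      \<le> 0.48 * (b - 1.02 / D) ^ 2"
    by (simp add: m_def)
qed

context haar_measure
begin

lemma pmf_p_U:
  assumes U: "U \<in> space M"
  shows "pmf (p_U d U) = col U"
proof
  fix x
  let ?f = "\<lambda>x. if x < d then cmod (U x 0) ^ 2 else 0"
  \<comment> \<open>Total mass 1 of the column is what makes \<open>embed_pmf\<close> return the
    given function.\<close>
  have "(\<integral>\<^sup>+ x. ennreal (?f x) \<partial>count_space UNIV) = (\<Sum>x<d. ennreal (?f x))"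
    by (rule nn_integral_count_space') auto
  also have "\<dots> = (\<Sum>x<d. ennreal (col U x))"
    by (intro sum.cong) (simp_all add: col_def)
  also have "\<dots> = 1"
    by (simp add: sum_col[OF U])
  finally have "pmf (p_U d U) x = ?f x"
    unfolding p_U_def by (intro pmf_embed_pmf) auto
  then show "pmf (p_U d U) x = col U x"
    using col_outside[OF U, of x] by (auto simp: col_def)
qed

lemma set_pmf_p_U: "U \<in> space M \<Longrightarrow> set_pmf (p_U d U) \<subseteq> {..<d}"
  using col_outside by (force simp: set_pmf_eq pmf_p_U not_less[symmetric])

lemma expectation_p_U:
  "U \<in> space M \<Longrightarrow> measure_pmf.expectation (replicate_pmf n (p_U d U)) f = iid_sum d (col U) n f"
  by (simp add: expectation_replicate_pmf[OF set_pmf_p_U] pmf_p_U)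

lemma finite_distribution_col: "U \<in> space M \<Longrightarrow> finite_distribution d (col U)"
  by unfold_locales (simp_all add: col_outside sum_col)

lemma bounded_measurable_iid_sum: "bounded_measurable (\<lambda>U. iid_sum d (col U) n f)"
proof (induction n arbitrary: f)
  case (Suc n)
  then show ?case
    by (simp del: iid_sum.simps(1))
qed simp

text \<open>A one-sided Chebyshev (Cantelli) bound: the square is centred at a point \<open>b\<close> beyond
  the mean purity, which keeps the probability of low purity below 1/2 even for d = 2.\<close>
lemma few_collisions_average:
  assumes d: "2 \<le> d" and n: "10 ^ 9 * sqrt d \<le> n"
  shows "(\<integral>U. iid_sum d (col U) n (\<lambda>xs. of_bool (collisions xs \<le> 1.01 * pairs n / d)) \<partial>M) \<le> 0.481"
proof -
  define G where "G = (real d - 1) / (real d * (real d + 1))"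
  define b where "b = 2 / (real d + 1) + 0.85 * G"
  have D: "2 \<le> real d"
    using d by simp
  note arith = purity_variance_arith[OF D G_def b_def]
  define c where "c = (b - 1.02 / d) ^ 2"
  have c: "0 < c"
    using arith(1) by (simp add: c_def)
  let ?e = "\<lambda>U. iid_sum d (col U) n (\<lambda>xs. of_bool (collisions xs \<le> 1.01 * pairs n / d))"
  have bound: "?e U \<le> 0.001 + (purity U - b) ^ 2 / c"
    if U: "U \<in> space M" for U
  proof -
    interpret finite_distribution d "col U"
      by (rule finite_distribution_col[OF U])
    have "?e U \<le> iid_sum d (col U) n (\<lambda>xs. 1)"
      by (rule iid_sum_mono) simp
    then have 1: "?e U \<le> 1"
      by (simp add: iid_sum_const)
    \<comment> \<open>High purity leaves only the sampling error. At low purity the trivial bound 1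
      is dominated by the quadratic, as the purity is then at least \<open>b - 1.02 / d\<close> away
      from \<open>b\<close>.\<close>
    show "?e U \<le> 0.001 + (purity U - b) ^ 2 / c"
    proof (cases "1.02 / d \<le> purity U")
      case True
      then have "?e U \<le> 0.001"
        by (intro few_collisions_unlikely d n) (simp add: purity_def power_sum_def)
      moreover have "0 \<le> (purity U - b) ^ 2 / c"
        using c by simp
      ultimately show ?thesis
        by linarith
    next
      case False
      then have "(b - 1.02 / d) ^ 2 \<le> (b - purity U) ^ 2"
        using arith(1) by (intro power_mono) auto
      then have "1 \<le> (purity U - b) ^ 2 / c"
        using c by (simp add: c_def power2_commute)
      then show ?thesis
        using 1 by simp
    qed
  qed
  have "(\<integral>U. ?e U \<partial>M) \<le> (\<integral>U. 0.001 + (purity U - b) ^ 2 / c \<partial>M)"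
    by (rule integral_mono) (use bound in \<open>auto simp: bounded_measurable_iid_sum\<close>)
  also have "\<dots> = 0.001 + (\<integral>U. (purity U - b) ^ 2 \<partial>M) / c"
    using prob_space by simp
  also have "(\<integral>U. (purity U - b) ^ 2 \<partial>M) = (\<integral>U. purity U ^ 2 - 2 * b * purity U + b ^ 2 \<partial>M)"
    by (simp add: power2_eq_square algebra_simps)
  also have "\<dots> = 4 * (real d + 5) / ((real d + 1) * (real d + 2) * (real d + 3))
      - 2 * b * (2 / (real d + 1)) + b ^ 2"
    using prob_space by (simp add: mean_purity mean_purity_square)
  also have "0.001 + \<dots> / c \<le> 0.001 + 0.48 * c / c"
    using arith(2) c unfolding c_def by (intro add_left_mono divide_right_mono) auto
  finally show ?thesis
    using c by simp
qed

end

theorem theorem3: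
  shows "\<exists>C::real. C > 0 \<and> (\<forall>d::nat. d \<ge> 2 \<longrightarrow>
     (\<exists>(N::nat) (T :: nat list \<Rightarrow> real).
        real N \<le> C * sqrt (real d) \<and>
        (\<forall>xs. 0 \<le> T xs \<and> T xs \<le> 1) \<and>
        measure_pmf.expectation (replicate_pmf N (pmf_of_set {..<d})) (\<lambda>xs. 1 - T xs) \<ge> 2/3 \<and>
        (\<forall>M. haar_unitary d M \<longrightarrow>
           (\<integral>U. measure_pmf.expectation (replicate_pmf N (p_U d U)) T \<partial>M) \<ge> 2/3)))"
proof (intro exI[of _ "10 ^ 9 + 1 :: real"] conjI allI impI)
  fix d :: nat assume d: "2 \<le> d"
  define n where "n = nat \<lceil>10 ^ 9 * sqrt d\<rceil>"
  have n: "10 ^ 9 * sqrt d \<le> n"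
    unfolding n_def by (rule real_nat_ceiling_ge)
  \<comment> \<open>The extra 1 in the constant pays for rounding up, since \<open>sqrt d\<close> is
    at least 1.\<close>
  have n': "n \<le> (10 ^ 9 + 1) * sqrt d"
  proof -
    have "real n \<le> 10 ^ 9 * sqrt d + 1"
      unfolding n_def using of_int_ceiling_le_add_one[of "10 ^ 9 * sqrt d"] by simp
    moreover have "1 \<le> sqrt d"
      using d by simp
    ultimately show ?thesis
      by (simp only: distrib_right)
  qed
  define few where "few xs \<longleftrightarrow> collisions xs \<le> 1.01 * pairs n / d" for xs :: "nat list"
  \<comment> \<open>Even without many collisions the test reports \<open>H\<^sub>1\<close> with probability 0.33: this spends the
    error allowed under \<open>H\<^sub>0\<close>, and then missing almost half of the unitaries is affordable.\<close>
  define T :: "nat list \<Rightarrow> real" where "T xs = 1 - 0.67 * of_bool (few xs)" for xs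
  have H0: "2 / 3 \<le> measure_pmf.expectation (replicate_pmf n (pmf_of_set {..<d})) (\<lambda>xs. 1 - T xs)"
  proof -
    have ne: "{..<d} \<noteq> {}"
      using d by (auto simp: lessThan_empty_iff)
    let ?u = "pmf (pmf_of_set {..<d})"
    interpret finite_distribution d ?u
      using d ne by unfold_locales (auto simp: indicator_def)
    have q: "power_sum 2 = 1 / d"
      using d ne by (simp add: power_sum_def power2_eq_square)
    \<comment> \<open>The success probability is at least \<open>0.67 * 0.999\<close>, just above
      2/3.\<close>
    have "iid_sum d ?u n (\<lambda>xs. of_bool (\<not> few xs)) \<le> 0.001"
      unfolding few_def by (rule many_collisions_unlikely[OF d n q])
    moreover have "(\<lambda>xs. 1 - T xs) = (\<lambda>xs. 0.67 + (- 0.67) * of_bool (\<not> few xs))"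
      by (auto simp: T_def)
    then have "iid_sum d ?u n (\<lambda>xs. 1 - T xs) = 0.67 + (- 0.67) * iid_sum d ?u n (\<lambda>xs. of_bool (\<not> few xs))"
      by (simp only: iid_sum_add iid_sum_const iid_sum_cmult)
    ultimately show ?thesis
      using ne by (subst expectation_replicate_pmf[of _ d]) auto
  qed
  have H1: "2 / 3 \<le> (\<integral>U. measure_pmf.expectation (replicate_pmf n (p_U d U)) T \<partial>M)"
    if "haar_unitary d M" for M
  proof -
    interpret haar_measure d M
      using that d by unfold_locales auto
    let ?e = "\<lambda>U. iid_sum d (col U) n (\<lambda>xs. of_bool (few xs))"
    have "(\<integral>U. measure_pmf.expectation (replicate_pmf n (p_U d U)) T \<partial>M) = (\<integral>U. 1 + (- 0.67) * ?e U \<partial>M)"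
    proof (rule Bochner_Integration.integral_cong[OF refl])
      fix U assume U: "U \<in> space M"
      interpret finite_distribution d "col U"
        by (rule finite_distribution_col[OF U])
      have "T = (\<lambda>xs. 1 + (- 0.67) * of_bool (few xs))"
        by (auto simp: T_def)
      then show "measure_pmf.expectation (replicate_pmf n (p_U d U)) T = 1 + (- 0.67) * ?e U"
        by (simp only: expectation_p_U[OF U] iid_sum_add iid_sum_const iid_sum_cmult)
    qed
    \<comment> \<open>The average error is at most \<open>0.67 * 0.481\<close>, which stays below
      1/3.\<close>
    also have "\<dots> = 1 - 0.67 * (\<integral>U. ?e U \<partial>M)"
      using prob_space bounded_measurable_iid_sum by simp
    finally show ?thesis
      using few_collisions_average[OF d n] by (simp add: few_def)
  qed
  show "\<exists>(N::nat) (T :: nat list \<Rightarrow> real).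
        real N \<le> (10 ^ 9 + 1) * sqrt (real d) \<and>
        (\<forall>xs. 0 \<le> T xs \<and> T xs \<le> 1) \<and>
        measure_pmf.expectation (replicate_pmf N (pmf_of_set {..<d})) (\<lambda>xs. 1 - T xs) \<ge> 2/3 \<and>
        (\<forall>M. haar_unitary d M \<longrightarrow>
           (\<integral>U. measure_pmf.expectation (replicate_pmf N (p_U d U)) T \<partial>M) \<ge> 2/3)"
    using n' H0 H1 by (intro exI[of _ n] exI[of _ T]) (auto simp: T_def)
qed simp

end
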